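(* Let $p,q$ be complex numbers. The generating function of the even-indexed $(p,q)$-Lucas numbers is, as a formal power series in $z$, $$\sum_{n=0}^{\infty}L_{p,q,2n}z^n=\frac{2-(p^2+2q)z}{1-(p^2+2q)z+q^2z^2}.$$
   Context: The $(p,q)$-Lucas numbers are defined by $L_{p,q,0}=2$, $L_{p,q,1}=p$, and $L_{p,q,n}=pL_{p,q,n-1}+qL_{p,q,n-2}$ for $n\ge 2$. *)

theory Defs
  imports Complex_Main "HOL-Computational_Algebra.Formal_Power_Series"
begin

fun lucas_pq :: "complex \<Rightarrow> complex \<Rightarrow> nat \<Rightarrow> complex" where
  "lucas_pq p q 0 = 2"
| "lucas_pq p q (Suc 0) = p"
| "lucas_pq p q (Suc (Suc n)) = p * lucas_pq p q (Suc n) + q * lucas_pq p q n"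

end

theory Submission
  imports Defs
begin

text \<open>If \<open>a\<close> and \<open>b\<close> are the roots of x^2 = p x + q, then L_n = a^n
  + b^n, and a^2 + b^2 = p^2 + 2q, a^2 b^2 = q^2. So the even-indexed terms obey a second-order
  recurrence with these coefficients (\<open>lucas_pq_step_two\<close>, proved directly by
  unfolding). Multiplying the series by the denominator then kills every coefficient from degree 2
  on, and the terms L_0 and L_2 give the numerator.\<close>

lemma lucas_pq_step_two:
  "lucas_pq p q (n + 4) = (p^2 + 2 * q) * lucas_pq p q (n + 2) - q^2 * lucas_pq p q n"
proof -
  have "n + 4 = Suc (Suc (Suc (Suc n)))" "n + 2 = Suc (Suc n)"
    by simp_all
  then show ?thesis
    by (simp only: lucas_pq.simps) (simp add: power2_eq_square algebra_simps)
qed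

lemma fps_even_lucas_pq_mult:
  "Abs_fps (\<lambda>n. lucas_pq p q (2 * n)) *
    (1 - fps_const (p^2 + 2 * q) * fps_X + fps_const (q^2) * fps_X^2) =
    2 - fps_const (p^2 + 2 * q) * fps_X"
  (is "?F * ?D = ?N")
proof (rule fps_ext)
  fix n :: nat
  \<comment> \<open>With the powers of \<open>fps_X\<close> on the left, each product is a
    coefficient shift.\<close>
  have expand: "?F * ?D = ?F - fps_const (p^2 + 2 * q) * (fps_X * ?F)
      + fps_const (q^2) * (fps_X^2 * ?F)"
    by (simp add: algebra_simps)
  have numeral: "(2 :: complex fps) = fps_const 2"
    by (simp add: numeral_fps_const)
  consider "n = 0" | "n = 1" | m where "n = m + 2"
    by (metis One_nat_def add_2_eq_Suc' not0_implies_Suc)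
  then show "fps_nth (?F * ?D) n = fps_nth ?N n"
  proof cases
    case 1
    then show ?thesis
      unfolding expand numeral by (simp add: fps_X_power_mult_nth)
  next
    case 2
    then show ?thesis
      unfolding expand numeral
      by (simp add: fps_X_power_mult_nth numeral_2_eq_2 power2_eq_square algebra_simps)
  next
    case (3 m)
    \<comment> \<open>The three shifted coefficients have Lucas indices 2m+4, 2m+2 and 2m, so they
      cancel by the recurrence.\<close>
    have "2 * n = 2 * m + 4" "2 * (n - 1) = 2 * m + 2" "n - 2 = m" "n \<noteq> 0" "n \<noteq> 1" "\<not> n < 2"
      using 3 by simp_all
    then show ?thesis
      unfolding expand numeral
      by (simp add: fps_X_power_mult_nth lucas_pq_step_two del: lucas_pq.simps)
  qed
qed

theorem theorem6:
  fixes p q :: complex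
  shows "Abs_fps (\<lambda>n. lucas_pq p q (2 * n)) =
    (2 - fps_const (p^2 + 2 * q) * fps_X) /
    (1 - fps_const (p^2 + 2 * q) * fps_X + fps_const (q^2) * fps_X^2)"
  (is "?F = ?N / ?D")
proof -
  \<comment> \<open>Constant term 1 makes the denominator nonzero, so it can be cancelled.\<close>
  have "fps_nth ?D 0 = 1"
    by simp
  then have "?D \<noteq> 0"
    by (metis fps_zero_nth zero_neq_one)
  then show ?thesis
    by (metis fps_even_lucas_pq_mult nonzero_mult_div_cancel_right)
qed

end
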